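(* Let $x_{t+1}=T(x_t)$ be a $G$-equivariant discrete-time dynamical system on $M\subset\mathbb{R}^n$, and let $\mathbb{U}:\mathcal{F}(M)\to\mathcal{F}(M)$ be its associated Koopman operator. If $\lambda$ is an eigenvalue of $\mathbb{U}$ and $\mathcal{E}_\lambda$ is the corresponding eigenspace, then $\mathcal{E}_\lambda$ is invariant under the action of $G$; that is, $g\star\phi\in\mathcal{E}_\lambda$ for all $g\in G$ and $\phi\in\mathcal{E}_\lambda$.
   Context: Standing assumptions: $G$ is a finite subgroup of $O(n)$, $M\subset\mathbb{R}^n$ is a compact $G$-invariant set, $G$ acts on $M$ by matrix multiplication (written $g\cdot x$), and $T:M\to M$ is at least $C^1$. The system $x_{t+1}=T(x_t)$ is $G$-equivariant if $T(g\cdot x)=g\cdot T(x)$ for all $g\in G$, $x\in M$. $\mathcal{F}(M)$ is a (complex) vector space of functions (observables) on $M$ that is mapped into itself by the Koopman operator $\mathbb{U}$, defined by $[\mathbb{U}h](x)=h(T(x))$, and on which $G$ acts by $(g\star f)(x)=f(g^{-1}\cdot x)$ (so $g\star f\in\mathcal{F}(M)$ whenever $f\in\mathcal{F}(M)$). The eigenspace $\mathcal{E}_\lambda$ is the linear span of the eigenfunctions of $\mathbb{U}$ with eigenvalue $\lambda$, i.e. of the nonzero $\phi\in\mathcal{F}(M)$ with $\mathbb{U}\phi=\lambda\phi$. *)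

theory Defs
  imports "HOL-Analysis.Analysis" "HOL-Algebra.Group" "HOL-Library.Function_Algebras"
begin

definition orthogonal_group :: "(real^'n^'n) monoid" where
  "orthogonal_group =
     \<lparr>carrier = {A. orthogonal_matrix A}, monoid.mult = (**), one = mat 1\<rparr>"

lemma orthogonal_group_simps [simp]:
  "carrier orthogonal_group = {A. orthogonal_matrix A}"
  "x \<otimes>\<^bsub>orthogonal_group\<^esub> y = x ** y"
  "\<one>\<^bsub>orthogonal_group\<^esub> = mat 1"
  by (simp_all add: orthogonal_group_def)

lemma matrix_inv_orthogonal:
  fixes A :: "real^'n^'n"
  assumes "orthogonal_matrix A"
  shows "matrix_inv A = transpose A"
proof -
  have tA: "transpose A ** A = mat 1" "A ** transpose A = mat 1"
    using assms by (simp_all add: orthogonal_matrix_def)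
  then have "invertible A"
    unfolding invertible_def by blast
  then have "A ** matrix_inv A = mat 1"
    using someI_ex[of "\<lambda>B. A ** B = mat 1 \<and> B ** A = mat 1"]
    unfolding matrix_inv_def invertible_def by blast
  then have "(transpose A ** A) ** matrix_inv A = transpose A"
    by (simp add: matrix_mul_assoc[symmetric])
  then show ?thesis
    by (simp add: tA)
qed

lemma group_orthogonal_group: "group (orthogonal_group :: (real^'n^'n) monoid)"
proof (rule groupI)
  fix x :: "real^'n^'n"
  assume "x \<in> carrier orthogonal_group"
  then show "\<exists>y\<in>carrier orthogonal_group.
      y \<otimes>\<^bsub>orthogonal_group\<^esub> x = \<one>\<^bsub>orthogonal_group\<^esub>"
    by (intro bexI[of _ "transpose x"]) (auto simp: orthogonal_matrix_def)
qed (auto simp: orthogonal_matrix_mul orthogonal_matrix_id matrix_mul_assoc)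

lemma inv_orthogonal_group:
  fixes A :: "real^'n^'n"
  assumes "orthogonal_matrix A"
  shows "inv\<^bsub>orthogonal_group\<^esub> A = matrix_inv A"
  by (rule group.inv_equality[OF group_orthogonal_group])
     (use assms in \<open>auto simp: matrix_inv_orthogonal orthogonal_matrix_def\<close>)

definition invariant_set :: "(real^'n^'n) set \<Rightarrow> (real^'n) set \<Rightarrow> bool" where
  "invariant_set G M \<longleftrightarrow> (\<forall>g\<in>G. \<forall>x\<in>M. g *v x \<in> M)"

text \<open>The set \<open>M\<close> need not be open, so \<open>C\<^sup>1\<close> is understood in the usual sense of having
  a continuously differentiable extension to an open neighbourhood of \<open>M\<close>.\<close>

definition C1_on :: "(real^'n) set \<Rightarrow> (real^'n \<Rightarrow> real^'n) \<Rightarrow> bool" where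
  "C1_on M T \<longleftrightarrow> (\<exists>U F (F' :: real^'n \<Rightarrow> (real^'n) \<Rightarrow>\<^sub>L (real^'n)).
     open U \<and> M \<subseteq> U \<and> (\<forall>x\<in>M. F x = T x) \<and>
     (\<forall>x\<in>U. (F has_derivative blinfun_apply (F' x)) (at x)) \<and> continuous_on U F')"

definition equivariant ::
    "(real^'n^'n) set \<Rightarrow> (real^'n) set \<Rightarrow> (real^'n \<Rightarrow> real^'n) \<Rightarrow> bool" where
  "equivariant G M T \<longleftrightarrow> (\<forall>g\<in>G. \<forall>x\<in>M. T (g *v x) = g *v T x)"

text \<open>A complex function on \<open>M\<close> is represented by the total function that agrees with it on \<open>M\<close>
  and is \<open>0\<close> off \<open>M\<close>. Thus equality of representatives is equality on \<open>M\<close>, and the pointwise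
  vector space operations on total functions are those of functions on \<open>M\<close>.\<close>

definition functions_on :: "'a set \<Rightarrow> ('a \<Rightarrow> complex) set" where
  "functions_on M = {f. \<forall>x. x \<notin> M \<longrightarrow> f x = 0}"

definition fun_scale :: "complex \<Rightarrow> ('a \<Rightarrow> complex) \<Rightarrow> 'a \<Rightarrow> complex" where
  "fun_scale c f = (\<lambda>x. c * f x)"

global_interpretation cfun: vector_space "fun_scale :: complex \<Rightarrow> ('a \<Rightarrow> complex) \<Rightarrow> 'a \<Rightarrow> complex"
  by standard (auto simp: fun_scale_def fun_eq_iff algebra_simps)

definition koopman :: "'a set \<Rightarrow> ('a \<Rightarrow> 'a) \<Rightarrow> ('a \<Rightarrow> complex) \<Rightarrow> 'a \<Rightarrow> complex" where
  "koopman M T h = (\<lambda>x. if x \<in> M then h (T x) else 0)"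

definition act :: "(real^'n) set \<Rightarrow> real^'n^'n \<Rightarrow> (real^'n \<Rightarrow> complex) \<Rightarrow> real^'n \<Rightarrow> complex" where
  "act M g f = (\<lambda>x. if x \<in> M then f (matrix_inv g *v x) else 0)"

definition eigenfunctions ::
    "('a \<Rightarrow> complex) set \<Rightarrow> (('a \<Rightarrow> complex) \<Rightarrow> 'a \<Rightarrow> complex) \<Rightarrow> complex \<Rightarrow> ('a \<Rightarrow> complex) set" where
  "eigenfunctions \<F> L \<mu> = {\<phi>\<in>\<F>. \<phi> \<noteq> 0 \<and> L \<phi> = fun_scale \<mu> \<phi>}"

definition is_eigenvalue ::
    "('a \<Rightarrow> complex) set \<Rightarrow> (('a \<Rightarrow> complex) \<Rightarrow> 'a \<Rightarrow> complex) \<Rightarrow> complex \<Rightarrow> bool" where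
  "is_eigenvalue \<F> L \<mu> \<longleftrightarrow> eigenfunctions \<F> L \<mu> \<noteq> {}"

definition eigenspace ::
    "('a \<Rightarrow> complex) set \<Rightarrow> (('a \<Rightarrow> complex) \<Rightarrow> 'a \<Rightarrow> complex) \<Rightarrow> complex \<Rightarrow> ('a \<Rightarrow> complex) set" where
  "eigenspace \<F> L \<mu> = cfun.span (eigenfunctions \<F> L \<mu>)"

end

theory Submission
  imports Defs
begin

text \<open>By equivariance the linear map \<open>act M g\<close> commutes with the Koopman operator
  (\<open>koopman_act\<close>), so it sends a solution of
  \<open>koopman M T f = fun_scale \<mu> f\<close> to another solution. Each eigenfunction thus goes
  to an eigenfunction or to 0, and linearity carries this over to their span.\<close>

lemma act_zero [simp]: "act M g 0 = 0"
  by (simp add: act_def fun_eq_iff)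

lemma act_add: "act M g (f + h) = act M g f + act M g h"
  by (simp add: act_def fun_eq_iff)

lemma act_fun_scale: "act M g (fun_scale c f) = fun_scale c (act M g f)"
  by (simp add: act_def fun_scale_def fun_eq_iff)

lemma matrix_inv_mem_subgroup:
  assumes "subgroup G orthogonal_group" and "g \<in> G"
  shows "matrix_inv g \<in> G"
proof -
  have "orthogonal_matrix g"
    using subgroup.mem_carrier[OF assms] by simp
  then show ?thesis
    using subgroup.m_inv_closed[OF assms] by (simp add: inv_orthogonal_group)
qed

text \<open>At \<open>x\<close> in \<open>M\<close> the two sides are
  \<open>f (matrix_inv g *v T x)\<close> and \<open>f (T (matrix_inv g *v x))\<close>, equal by
  equivariance at \<open>matrix_inv g\<close>. Both \<open>T x\<close> and
  \<open>matrix_inv g *v x\<close> stay in \<open>M\<close>, so the default value 0 arises only for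
  \<open>x\<close> off \<open>M\<close>, on both sides.\<close>

lemma koopman_act:
  assumes "matrix_inv g \<in> G" and "invariant_set G M" and "T \<in> M \<rightarrow> M" and "equivariant G M T"
  shows "koopman M T (act M g f) = act M g (koopman M T f)"
proof
  fix x
  show "koopman M T (act M g f) x = act M g (koopman M T f) x"
    using assms by (auto simp: koopman_def act_def invariant_set_def equivariant_def)
qed

theorem proposition2:
  fixes G :: "(real^'n^'n) set"
    and M :: "(real^'n) set"
    and T :: "real^'n \<Rightarrow> real^'n"
    and \<F> :: "(real^'n \<Rightarrow> complex) set"
    and \<mu> :: complex
  assumes "subgroup G orthogonal_group" and "finite G"
    and "compact M" and "invariant_set G M"
    and "T \<in> M \<rightarrow> M" and "C1_on M T"
    and "equivariant G M T"
    and "cfun.subspace \<F>" and "\<F> \<subseteq> functions_on M"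
    and "\<And>h. h \<in> \<F> \<Longrightarrow> koopman M T h \<in> \<F>"
    and "\<And>g f. g \<in> G \<Longrightarrow> f \<in> \<F> \<Longrightarrow> act M g f \<in> \<F>"
    and "is_eigenvalue \<F> (koopman M T) \<mu>"
  shows "\<forall>g\<in>G. \<forall>\<phi>\<in>eigenspace \<F> (koopman M T) \<mu>.
           act M g \<phi> \<in> eigenspace \<F> (koopman M T) \<mu>"
proof (intro ballI)
  let ?U = "koopman M T"
  let ?E = "eigenspace \<F> ?U \<mu>"
  fix g \<phi>
  assume g: "g \<in> G" and \<phi>: "\<phi> \<in> ?E"
  have commute: "?U (act M g f) = act M g (?U f)" for f
    using koopman_act matrix_inv_mem_subgroup assms(1,4,5,7) g by blast
  have eigenfunction: "act M g \<psi> \<in> ?E" if "\<psi> \<in> eigenfunctions \<F> ?U \<mu>" for \<psi>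
  \<comment> \<open>Eigenfunctions are nonzero by definition; the split replaces an argument that
    \<open>act M g\<close> is injective on functions on \<open>M\<close>.\<close>
  proof (cases "act M g \<psi> = 0")
    case True
    then show ?thesis
      by (simp add: eigenspace_def cfun.span_zero)
  next
    case False
    with that have "act M g \<psi> \<in> eigenfunctions \<F> ?U \<mu>"
      using assms(11) g by (simp add: eigenfunctions_def commute act_fun_scale)
    then show ?thesis
      by (simp add: eigenspace_def cfun.span_base)
  qed
  \<comment> \<open>The preimage of a subspace under a linear map is a subspace; containing all
    eigenfunctions, it contains their span.\<close>
  have "cfun.subspace {f. act M g f \<in> ?E}"
    by (rule cfun.subspaceI)
      (auto simp: eigenspace_def act_add act_fun_scale cfun.span_zero cfun.span_add cfun.span_scale)
  with \<phi> eigenfunction show "act M g \<phi> \<in> ?E"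
    using cfun.span_induct[of \<phi> "eigenfunctions \<F> ?U \<mu>" "\<lambda>f. act M g f \<in> ?E"]
    by (simp add: eigenspace_def)
qed

end
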